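(* Let $h>0$, let $f:\Omega_h\to\mathbb{R}$, and let $u_h$ be a classical solution of the discrete Hamilton–Jacobi equation of the context with initial data $u_h(\vec{x}_l,0)=f(\vec{x}_l)$ for all $\vec{x}_l\in\Omega_h$, $l\in\Gamma_h$. Then $u_h(\vec{x}_l,t)$ has the representation $$u_h(\vec{x}_l,t)=\max_{\vec{v},\vec{p}}\Big\{\sum_{i\in\Gamma_h}f(\vec{x}_i)p_t(\vec{x}_i)-\int_0^t\sum_{i\in\Gamma_h}\tilde{L}_h(\vec{x}_i,\vec{v}_{t-s})\,p_{t-s}(\vec{x}_i)\,ds\Big\},$$ where the maximum is over pairs $(\vec{v},\vec{p})$ subject to $$\dot{p}_s(\vec{x}_i)=\sum_{k\in\Gamma_h}\Big(\frac1h v_s(\vec{x}_k,\vec{x}_i)\Phi(\vec{x}_k,\vec{x}_i)p_s(\vec{x}_k)-\frac1h v_s(\vec{x}_i,\vec{x}_k)\Phi(\vec{x}_i,\vec{x}_k)p_s(\vec{x}_i)\Big),\qquad \vec{x}_i\in\Omega_h,$$ $$p_{s=0}(\vec{x}_i)=\delta_{il},\qquad \sum_{\vec{x}_i\in\Omega_h^c}p_s(\vec{x}_i)\equiv 0,$$ $$v_s(\vec{x}_i,\vec{x}_k)\ge 0\ \text{ for } k\neq i,\qquad \sum_{k\in\Gamma_h}v_s(\vec{x}_i,\vec{x}_k)\Phi(\vec{x}_i,\vec{x}_k)=0\quad\text{for any } s\in[0,t].$$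
   Context: $\mathbb{N}$ includes $0$. $\Omega\subset\mathbb{R}^N_+:=\{x\in\mathbb{R}^N:x_i>0\ \forall i\}$ is a bounded open domain with $\overline{\Omega}\subset\mathbb{R}^N_+$, and $\Omega_h=\{h\vec{i}:\vec{i}\in\mathbb{N}^N\}\cap\overline{\Omega}=\{\vec{x}_i:i\in\Gamma_h\}$ with $\Gamma_h$ a finite index set. There are $M$ reactions with reaction vectors $\vec{\nu}_1,\dots,\vec{\nu}_M\in\mathbb{Z}^N$. The intensities $\Phi_j^\pm:\overline{\Omega}\to\mathbb{R}$ are continuous with $\Phi_j^\pm\ge c_0>0$. Discrete Hamilton–Jacobi equation: for $\vec{x}_i\in\Omega_h$, $t>0$, $$\partial_tu_h(\vec{x}_i,t)=\sum_{j:\,\vec{x}_i+\vec{\nu}_jh\in\Omega_h}\Phi_j^+(\vec{x}_i)\Big(e^{\frac{u_h(\vec{x}_i+\vec{\nu}_jh,t)-u_h(\vec{x}_i,t)}{h}}-1\Big)+\sum_{j:\,\vec{x}_i-\vec{\nu}_jh\in\Omega_h}\Phi_j^-(\vec{x}_i)\Big(e^{\frac{u_h(\vec{x}_i-\vec{\nu}_jh,t)-u_h(\vec{x}_i,t)}{h}}-1\Big),$$ with $j$ ranging over $\{1,\dots,M\}$. A classical solution is one that is $C^1$ in $t\in[0,\infty)$ at each grid point. Let $\mathcal{N}_i=\{k\in\Gamma_h:\vec{x}_k\in\{\vec{x}_i\pm\vec{\nu}_jh:j=1,\dots,M\}\}$. Define $\Phi:\Omega_h\times\Omega_h\to\mathbb{R}$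 by $\Phi(\vec{x}_i,\vec{x}_k)=\Phi_{j}^+(\vec{x}_i)$ if $\vec{x}_k=\vec{x}_i+\vec{\nu}_jh$ for some $j=j(k)$; $\Phi(\vec{x}_i,\vec{x}_k)=\Phi_{j}^-(\vec{x}_i)$ if $\vec{x}_k=\vec{x}_i-\vec{\nu}_jh$ for some $j=j(k)$; $\Phi(\vec{x}_i,\vec{x}_k)=0$ if $k\ne i$ and $k\notin\mathcal{N}_i$; and $\Phi(\vec{x}_i,\vec{x}_i)=-\sum_{k\in\mathcal{N}_i}\Phi(\vec{x}_i,\vec{x}_k)$. Here $\vec{v}_s$ is a control velocity with components $v_s(\vec{x}_i,\vec{x}_k)$, and $p_s$ is a probability density on the grid. The running cost is $$\tilde{L}_h(\vec{x}_i,\vec{v})=\sum_{k\in\mathcal{N}_i}\Phi(\vec{x}_i,\vec{x}_k)\big(v(\vec{x}_i,\vec{x}_k)\log v(\vec{x}_i,\vec{x}_k)-v(\vec{x}_i,\vec{x}_k)+1\big),$$ with $0\log 0=0$.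
   Formalization: Φ(x_i,x_k) is taken as the sum of all intensities of reactions leading from x_i to x_k (the same when j(k) is unique), and N_i excludes i; with a single Φ_j the formula fails when two reactions share a vector up to sign, and zero vectors make Φ(x_i,x_i) ill-defined. *)

theory Defs
  imports "HOL-Analysis.Analysis"
begin

text \<open>
  The ambient space \<^typ>\<open>real ^ 'n\<close> is R^N with N = CARD('n). Reactions are numbered 1..M; the
  arguments \<open>\<Phi>p j\<close> and \<open>\<Phi>m j\<close> are the forward and backward intensities of reaction j.
  Grid functions take the grid points themselves as arguments, so sums over the index set Gamma_h
  become sums over \<open>dom_grid \<Omega> h\<close>.
\<close>

definition pos_orthant :: "(real ^ 'n) set" where
  "pos_orthant = {x. \<forall>i. x $ i > 0}"

definition lattice :: "real \<Rightarrow> (real ^ 'n) set" where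
  "lattice h = range (\<lambda>k :: nat ^ 'n. h *\<^sub>R (\<chi> i. real (k $ i)))"

definition dom_grid :: "(real ^ 'n) set \<Rightarrow> real \<Rightarrow> (real ^ 'n) set" where
  "dom_grid \<Omega> h = lattice h \<inter> closure \<Omega>"

definition jump :: "(nat \<Rightarrow> int ^ 'n) \<Rightarrow> real \<Rightarrow> nat \<Rightarrow> real ^ 'n" where
  "jump \<nu> h j = h *\<^sub>R (\<chi> i. real_of_int (\<nu> j $ i))"

definition hj_rhs ::
  "(real ^ 'n) set \<Rightarrow> nat \<Rightarrow> (nat \<Rightarrow> int ^ 'n) \<Rightarrow> (nat \<Rightarrow> real ^ 'n \<Rightarrow> real) \<Rightarrow> (nat \<Rightarrow> real ^ 'n \<Rightarrow> real)
    \<Rightarrow> real \<Rightarrow> (real ^ 'n \<Rightarrow> real) \<Rightarrow> real ^ 'n \<Rightarrow> real" where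
  "hj_rhs \<Omega> M \<nu> \<Phi>p \<Phi>m h w x =
     (\<Sum>j | j \<in> {1..M} \<and> x + jump \<nu> h j \<in> dom_grid \<Omega> h.
        \<Phi>p j x * (exp ((w (x + jump \<nu> h j) - w x) / h) - 1))
   + (\<Sum>j | j \<in> {1..M} \<and> x - jump \<nu> h j \<in> dom_grid \<Omega> h.
        \<Phi>m j x * (exp ((w (x - jump \<nu> h j) - w x) / h) - 1))"

text \<open>At the time 0 the derivative is one-sided.\<close>

definition C1_half_line :: "(real \<Rightarrow> real) \<Rightarrow> bool" where
  "C1_half_line g \<longleftrightarrow>
     (\<exists>g'. continuous_on {0..} g' \<and> (\<forall>t\<ge>0. (g has_real_derivative g' t) (at t within {0..})))"

definition classical_solution ::
  "(real ^ 'n) set \<Rightarrow> nat \<Rightarrow> (nat \<Rightarrow> int ^ 'n) \<Rightarrow> (nat \<Rightarrow> real ^ 'n \<Rightarrow> real) \<Rightarrow> (nat \<Rightarrow> real ^ 'n \<Rightarrow> real)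
    \<Rightarrow> real \<Rightarrow> (real ^ 'n \<Rightarrow> real \<Rightarrow> real) \<Rightarrow> bool" where
  "classical_solution \<Omega> M \<nu> \<Phi>p \<Phi>m h u \<longleftrightarrow>
     (\<forall>x\<in>dom_grid \<Omega> h. C1_half_line (u x) \<and>
        (\<forall>t>0. (u x has_real_derivative hj_rhs \<Omega> M \<nu> \<Phi>p \<Phi>m h (\<lambda>y. u y t) x) (at t)))"

text \<open>
  A grid point is not counted among its own neighbours; this only matters for a zero
  reaction vector, which contributes nothing to the equation.
\<close>

definition nbrs ::
  "(real ^ 'n) set \<Rightarrow> nat \<Rightarrow> (nat \<Rightarrow> int ^ 'n) \<Rightarrow> real \<Rightarrow> real ^ 'n \<Rightarrow> (real ^ 'n) set" where
  "nbrs \<Omega> M \<nu> h x =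
     {y \<in> dom_grid \<Omega> h. y \<noteq> x \<and> (\<exists>j\<in>{1..M}. y = x + jump \<nu> h j \<or> y = x - jump \<nu> h j)}"

text \<open>
  The off-diagonal rate of the jump from \<open>x\<close> to \<open>y\<close>. If exactly one signed reaction leads from
  \<open>x\<close> to \<open>y\<close>, this is its intensity (lemmas \<open>offdiag_rate_plus\<close>, \<open>offdiag_rate_minus\<close>). If several
  do, their intensities add up, in agreement with the sums over j in \<^const>\<open>hj_rhs\<close>.
  If none does, the rate is 0.
\<close>

definition offdiag_rate ::
  "nat \<Rightarrow> (nat \<Rightarrow> int ^ 'n) \<Rightarrow> (nat \<Rightarrow> real ^ 'n \<Rightarrow> real) \<Rightarrow> (nat \<Rightarrow> real ^ 'n \<Rightarrow> real)
    \<Rightarrow> real \<Rightarrow> real ^ 'n \<Rightarrow> real ^ 'n \<Rightarrow> real" where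
  "offdiag_rate M \<nu> \<Phi>p \<Phi>m h x y =
     (\<Sum>j | j \<in> {1..M} \<and> y = x + jump \<nu> h j. \<Phi>p j x)
   + (\<Sum>j | j \<in> {1..M} \<and> y = x - jump \<nu> h j. \<Phi>m j x)"

lemma offdiag_rate_plus:
  assumes "{i \<in> {1..M}. y = x + jump \<nu> h i} = {j}" "{i \<in> {1..M}. y = x - jump \<nu> h i} = {}"
  shows "offdiag_rate M \<nu> \<Phi>p \<Phi>m h x y = \<Phi>p j x"
  by (simp only: assms offdiag_rate_def) simp

lemma offdiag_rate_minus:
  assumes "{i \<in> {1..M}. y = x + jump \<nu> h i} = {}" "{i \<in> {1..M}. y = x - jump \<nu> h i} = {j}"
  shows "offdiag_rate M \<nu> \<Phi>p \<Phi>m h x y = \<Phi>m j x"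
  by (simp only: assms offdiag_rate_def) simp

definition rate ::
  "(real ^ 'n) set \<Rightarrow> nat \<Rightarrow> (nat \<Rightarrow> int ^ 'n) \<Rightarrow> (nat \<Rightarrow> real ^ 'n \<Rightarrow> real) \<Rightarrow> (nat \<Rightarrow> real ^ 'n \<Rightarrow> real)
    \<Rightarrow> real \<Rightarrow> real ^ 'n \<Rightarrow> real ^ 'n \<Rightarrow> real" where
  "rate \<Omega> M \<nu> \<Phi>p \<Phi>m h x y =
     (if y = x then - (\<Sum>z\<in>nbrs \<Omega> M \<nu> h x. offdiag_rate M \<nu> \<Phi>p \<Phi>m h x z)
      else offdiag_rate M \<nu> \<Phi>p \<Phi>m h x y)"

text \<open>Here \<open>w y\<close> is the velocity component v(x,y). The convention 0 log 0 = 0 is automatic.\<close>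

definition running_cost ::
  "(real ^ 'n) set \<Rightarrow> nat \<Rightarrow> (nat \<Rightarrow> int ^ 'n) \<Rightarrow> (nat \<Rightarrow> real ^ 'n \<Rightarrow> real) \<Rightarrow> (nat \<Rightarrow> real ^ 'n \<Rightarrow> real)
    \<Rightarrow> real \<Rightarrow> real ^ 'n \<Rightarrow> (real ^ 'n \<Rightarrow> real) \<Rightarrow> real" where
  "running_cost \<Omega> M \<nu> \<Phi>p \<Phi>m h x w =
     (\<Sum>y\<in>nbrs \<Omega> M \<nu> h x. rate \<Omega> M \<nu> \<Phi>p \<Phi>m h x y * (w y * ln (w y) - w y + 1))"

text \<open>
  Pairs (v, p) over which the maximum is taken, where \<open>v s x y\<close> is the control velocity and \<open>p s\<close>
  a probability density on the full lattice. The differential equation holds at every time in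
  [0,t], with one-sided derivatives at the end points, and no regularity of \<open>v\<close> in time is asked
  for. As the running cost is nonnegative along such a pair, the last conjunct only excludes pairs
  whose cost integral is infinite or undefined, for which \<^const>\<open>integral\<close> would return 0.
\<close>

definition admissible ::
  "(real ^ 'n) set \<Rightarrow> nat \<Rightarrow> (nat \<Rightarrow> int ^ 'n) \<Rightarrow> (nat \<Rightarrow> real ^ 'n \<Rightarrow> real) \<Rightarrow> (nat \<Rightarrow> real ^ 'n \<Rightarrow> real)
    \<Rightarrow> real \<Rightarrow> real ^ 'n \<Rightarrow> real
    \<Rightarrow> (real \<Rightarrow> real ^ 'n \<Rightarrow> real ^ 'n \<Rightarrow> real) \<Rightarrow> (real \<Rightarrow> real ^ 'n \<Rightarrow> real) \<Rightarrow> bool" where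
  "admissible \<Omega> M \<nu> \<Phi>p \<Phi>m h l t v p \<longleftrightarrow>
     (\<forall>s\<in>{0..t}. (\<forall>x\<in>lattice h. p s x \<ge> 0) \<and> (p s has_sum 1) (lattice h)) \<and>
     (\<forall>s\<in>{0..t}. \<forall>x\<in>dom_grid \<Omega> h.
        ((\<lambda>r. p r x) has_real_derivative
          (\<Sum>y\<in>dom_grid \<Omega> h. 1 / h * v s y x * rate \<Omega> M \<nu> \<Phi>p \<Phi>m h y x * p s y
                           - 1 / h * v s x y * rate \<Omega> M \<nu> \<Phi>p \<Phi>m h x y * p s x))
        (at s within {0..t})) \<and>
     (\<forall>x\<in>dom_grid \<Omega> h. p 0 x = (if x = l then 1 else 0)) \<and>
     (\<forall>s\<in>{0..t}. (p s has_sum 0) (lattice h - dom_grid \<Omega> h)) \<and>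
     (\<forall>s\<in>{0..t}. \<forall>x\<in>dom_grid \<Omega> h.
        (\<forall>y\<in>dom_grid \<Omega> h. y \<noteq> x \<longrightarrow> v s x y \<ge> 0) \<and>
        (\<Sum>y\<in>dom_grid \<Omega> h. v s x y * rate \<Omega> M \<nu> \<Phi>p \<Phi>m h x y) = 0) \<and>
     (\<lambda>s. \<Sum>x\<in>dom_grid \<Omega> h. running_cost \<Omega> M \<nu> \<Phi>p \<Phi>m h x (v (t - s) x) * p (t - s) x)
        integrable_on {0..t}"

definition payoff ::
  "(real ^ 'n) set \<Rightarrow> nat \<Rightarrow> (nat \<Rightarrow> int ^ 'n) \<Rightarrow> (nat \<Rightarrow> real ^ 'n \<Rightarrow> real) \<Rightarrow> (nat \<Rightarrow> real ^ 'n \<Rightarrow> real)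
    \<Rightarrow> real \<Rightarrow> (real ^ 'n \<Rightarrow> real) \<Rightarrow> real
    \<Rightarrow> (real \<Rightarrow> real ^ 'n \<Rightarrow> real ^ 'n \<Rightarrow> real) \<Rightarrow> (real \<Rightarrow> real ^ 'n \<Rightarrow> real) \<Rightarrow> real" where
  "payoff \<Omega> M \<nu> \<Phi>p \<Phi>m h f t v p =
     (\<Sum>x\<in>dom_grid \<Omega> h. f x * p t x)
   - integral {0..t} (\<lambda>s. \<Sum>x\<in>dom_grid \<Omega> h.
       running_cost \<Omega> M \<nu> \<Phi>p \<Phi>m h x (v (t - s) x) * p (t - s) x)"

text \<open>\<^const>\<open>Max\<close> is meaningful for finite sets only.\<close>

definition is_maximum :: "real \<Rightarrow> real set \<Rightarrow> bool" where
  "is_maximum m S \<longleftrightarrow> m \<in> S \<and> (\<forall>y\<in>S. y \<le> m)"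

end

theory Submission
  imports Defs
begin

text \<open>
  The proof is a verification argument on the finite grid \<open>G\<close>. Write \<open>A x y\<close> for the rates and
  \<open>c = (u y s - u x s) / h\<close>. By \<open>hj_rhs_eq_rate_sum\<close> and \<open>sum_nbrs_eq\<close> the Hamiltonian at \<open>x\<close> is the sum
  over \<open>y\<close> of \<open>A x y * (exp c - 1)\<close>, and the running cost is the sum of
  \<open>A x y * (v * ln v - v + 1)\<close>, its Legendre transform in \<open>c\<close>.

  Let \<open>F s\<close> be the sum over the grid of \<open>u x s * p (t - s) x\<close>. It interpolates between the terminal
  reward \<open>F 0\<close>, the average of \<open>f\<close> under \<open>p t\<close>, and the value \<open>F t = u l t\<close>. Summation by parts turns
  its derivative into an average of \<open>A x y * (exp c - 1 - v * c)\<close>, and by the Fenchel-Young inequality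
  \<open>exp_fenchel_young\<close> this is at least minus the running cost. Integration shows that no admissible
  pair has a payoff above \<open>u l t\<close> (\<open>controlled_payoff_le_value\<close>), with equality for \<open>v = exp c\<close>
  (\<open>gradient_control_cost_has_integral\<close>).

  It remains to find a density driven by \<open>v = exp c\<close>. Instead of appealing to an existence theorem for
  linear systems with time-dependent coefficients, one uses that \<open>\<psi> = exp (u / h)\<close> solves the linear
  backward equation (\<open>cole_hopf_derivative\<close>) and that \<open>v\<close> is the quotient of two values of \<open>\<psi>\<close>. The
  required density is therefore the Doob h-transform by \<open>\<psi>\<close> of the solution of the autonomous forward
  equation (\<open>doob_transform_density\<close>), and the latter is an explicit power series with nonnegative
  coefficients, up to an exponential factor (\<open>nonneg_linear_system_solution\<close>).
\<close>

section \<open>The equation and the cost in terms of the jump rates\<close>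

lemma finite_dom_grid:
  assumes "bounded \<Omega>" and "h > 0"
  shows "finite (dom_grid \<Omega> h)"
proof -
  obtain R where R: "\<And>x. x \<in> closure \<Omega> \<Longrightarrow> norm x \<le> R"
    using bounded_closure[OF assms(1)] by (auto simp: bounded_iff)
  define S :: "(nat ^ 'a) set" where "S = vec_lambda ` (UNIV \<rightarrow>\<^sub>E {..nat \<lceil>R / h\<rceil>})"
  have "finite S"
    unfolding S_def by (intro finite_imageI finite_PiE) auto
  moreover have "dom_grid \<Omega> h \<subseteq> (\<lambda>k. h *\<^sub>R (\<chi> i. real (k $ i))) ` S"
  proof
    fix x assume "x \<in> dom_grid \<Omega> h"
    then obtain k :: "nat ^ 'a" where x: "x = h *\<^sub>R (\<chi> i. real (k $ i))" and "x \<in> closure \<Omega>"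
      by (auto simp: dom_grid_def lattice_def)
    have "k $ i \<le> nat \<lceil>R / h\<rceil>" for i
    proof -
      have "h * real (k $ i) \<le> R"
        using component_le_norm_cart[of x i] R[OF \<open>x \<in> closure \<Omega>\<close>] by (simp add: x)
      hence "real (k $ i) \<le> R / h"
        using assms(2) by (simp add: field_simps)
      thus ?thesis by linarith
    qed
    hence "vec_nth k \<in> UNIV \<rightarrow>\<^sub>E {..nat \<lceil>R / h\<rceil>}"
      by (simp add: PiE_UNIV_domain)
    hence "vec_lambda (vec_nth k) \<in> S"
      unfolding S_def by (rule imageI)
    hence "k \<in> S"
      by (simp only: vec_nth_inverse)
    thus "x \<in> (\<lambda>k. h *\<^sub>R (\<chi> i. real (k $ i))) ` S"
      unfolding x by (rule imageI)
  qed
  ultimately show ?thesis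
    by (meson finite_imageI finite_subset)
qed

text \<open>
  The equation sums over reactions, the control problem over grid points. Grouping the reactions
  by the point that they lead to translates one into the other. The point \<open>x\<close> itself can be left
  out, because \<open>g\<close> will be an increment \<open>exp ((w y - w x) / h) - 1\<close>, which vanishes there.
\<close>

lemma sum_over_reactions_by_target:
  fixes T :: "'j \<Rightarrow> 'a" and a :: "'j \<Rightarrow> real"
  assumes "finite G" "finite I" "g x = 0"
  shows "(\<Sum>j | j \<in> I \<and> T j \<in> G. a j * g (T j)) = (\<Sum>y\<in>G - {x}. (\<Sum>j | j \<in> I \<and> y = T j. a j) * g y)"
proof -
  have "(\<Sum>j | j \<in> I \<and> T j \<in> G. a j * g (T j))
      = (\<Sum>y\<in>G. \<Sum>j | j \<in> {j. j \<in> I \<and> T j \<in> G} \<and> T j = y. a j * g (T j))"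
    using assms by (intro sum.group[symmetric]) auto
  also have "\<dots> = (\<Sum>y\<in>G. (\<Sum>j | j \<in> I \<and> y = T j. a j) * g y)"
    by (intro sum.cong refl, subst sum_distrib_right, intro sum.cong) auto
  also have "\<dots> = (\<Sum>y\<in>G - {x}. (\<Sum>j | j \<in> I \<and> y = T j. a j) * g y)"
    using assms by (intro sum.mono_neutral_right) auto
  finally show ?thesis .
qed

lemma hj_rhs_eq_rate_sum:
  assumes "finite (dom_grid \<Omega> h)"
  shows "hj_rhs \<Omega> M \<nu> \<Phi>p \<Phi>m h w x
    = (\<Sum>y\<in>dom_grid \<Omega> h - {x}. rate \<Omega> M \<nu> \<Phi>p \<Phi>m h x y * (exp ((w y - w x) / h) - 1))"
proof -
  let ?g = "\<lambda>y. exp ((w y - w x) / h) - 1"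
  have "hj_rhs \<Omega> M \<nu> \<Phi>p \<Phi>m h w x
      = (\<Sum>y\<in>dom_grid \<Omega> h - {x}. offdiag_rate M \<nu> \<Phi>p \<Phi>m h x y * ?g y)"
    unfolding hj_rhs_def offdiag_rate_def distrib_right sum.distrib
    using sum_over_reactions_by_target[OF assms, where I = "{1..M}" and g = ?g and x = x
        and T = "\<lambda>j. x + jump \<nu> h j" and a = "\<lambda>j. \<Phi>p j x"]
      sum_over_reactions_by_target[OF assms, where I = "{1..M}" and g = ?g and x = x
        and T = "\<lambda>j. x - jump \<nu> h j" and a = "\<lambda>j. \<Phi>m j x"]
    by simp
  also have "\<dots> = (\<Sum>y\<in>dom_grid \<Omega> h - {x}. rate \<Omega> M \<nu> \<Phi>p \<Phi>m h x y * ?g y)"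
    by (intro sum.cong) (auto simp: rate_def)
  finally show ?thesis .
qed

text \<open>
  Off the diagonal a nonzero rate already forces the target to be a neighbour, so neighbourhoods can
  be replaced by the whole punctured grid. This keeps the rest of the argument free of geometry: it
  concerns a matrix \<open>A\<close> with nonnegative off-diagonal entries and vanishing row sums on a finite set.
\<close>

lemma sum_nbrs_eq:
  assumes "finite (dom_grid \<Omega> h)"
  shows "(\<Sum>y\<in>nbrs \<Omega> M \<nu> h x. rate \<Omega> M \<nu> \<Phi>p \<Phi>m h x y * g y)
    = (\<Sum>y\<in>dom_grid \<Omega> h - {x}. rate \<Omega> M \<nu> \<Phi>p \<Phi>m h x y * g y)"
proof (intro sum.mono_neutral_left ballI)
  fix y assume y: "y \<in> dom_grid \<Omega> h - {x} - nbrs \<Omega> M \<nu> h x"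
  hence "{j \<in> {1..M}. y = x + jump \<nu> h j} = {}" "{j \<in> {1..M}. y = x - jump \<nu> h j} = {}"
    by (auto simp: nbrs_def)
  hence "offdiag_rate M \<nu> \<Phi>p \<Phi>m h x y = 0"
    by (simp only: offdiag_rate_def) simp
  thus "rate \<Omega> M \<nu> \<Phi>p \<Phi>m h x y * g y = 0"
    using y by (simp add: rate_def)
qed (use assms in \<open>auto simp: nbrs_def\<close>)

lemma rate_diagonal:
  assumes "finite (dom_grid \<Omega> h)"
  shows "rate \<Omega> M \<nu> \<Phi>p \<Phi>m h x x = - (\<Sum>y\<in>dom_grid \<Omega> h - {x}. rate \<Omega> M \<nu> \<Phi>p \<Phi>m h x y)"
proof -
  have "rate \<Omega> M \<nu> \<Phi>p \<Phi>m h x x = - (\<Sum>y\<in>nbrs \<Omega> M \<nu> h x. rate \<Omega> M \<nu> \<Phi>p \<Phi>m h x y * 1)"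
    by (auto simp: rate_def nbrs_def intro!: sum.cong)
  thus ?thesis
    by (simp only: sum_nbrs_eq[OF assms]) simp
qed

lemma rate_nonneg:
  assumes "\<And>j. j \<in> {1..M} \<Longrightarrow> \<Phi>p j x \<ge> 0" "\<And>j. j \<in> {1..M} \<Longrightarrow> \<Phi>m j x \<ge> 0" "y \<noteq> x"
  shows "rate \<Omega> M \<nu> \<Phi>p \<Phi>m h x y \<ge> 0"
  using assms by (auto simp: rate_def offdiag_rate_def intro!: add_nonneg_nonneg sum_nonneg)

section \<open>Duality between the Hamiltonian and the running cost\<close>

text \<open>
  The Legendre transform of \<open>exp c - 1\<close> is \<open>v * ln v - v + 1\<close>. For \<open>v > 0\<close> the inequality is
  \<open>1 + z \<le> exp z\<close> at \<open>z = c - ln v\<close>, multiplied by \<open>v\<close>; in particular, equality holds for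
  \<open>v = exp c\<close>.
\<close>

lemma exp_fenchel_young:
  fixes c v :: real
  assumes "v \<ge> 0"
  shows "v * c - (exp c - 1) \<le> v * ln v - v + 1"
proof (cases "v = 0")
  case False
  hence "v > 0" using assms by simp
  have "1 + (c - ln v) \<le> exp (c - ln v)" by (rule exp_ge_add_one_self)
  also have "\<dots> = exp c / v" using \<open>v > 0\<close> by (simp add: exp_diff)
  finally have "v * (1 + (c - ln v)) \<le> exp c"
    using \<open>v > 0\<close> by (simp add: pos_le_divide_eq mult.commute)
  thus ?thesis by (simp add: algebra_simps)
qed simp

text \<open>
  The pairing of \<open>w\<close> with the right-hand side of the controlled master equation: renaming the
  summation variables in the gain term moves the difference onto \<open>w\<close>. The diagonal drops out
  because the gain and the loss at \<open>y = x\<close> cancel, whatever the value of \<open>v x x\<close>. With \<open>w\<close>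
  constant this is conservation of mass.
\<close>

lemma flux_summation_by_parts:
  fixes w p :: "'a \<Rightarrow> real" and h :: real
  assumes "finite G"
  shows "(\<Sum>x\<in>G. w x * (\<Sum>y\<in>G. 1 / h * v y x * A y x * p y - 1 / h * v x y * A x y * p x))
    = (\<Sum>x\<in>G. p x * (\<Sum>y\<in>G - {x}. A x y * (v x y * ((w y - w x) / h))))"
proof -
  have "(\<Sum>x\<in>G. w x * (\<Sum>y\<in>G. 1 / h * v y x * A y x * p y - 1 / h * v x y * A x y * p x))
    = (\<Sum>x\<in>G. \<Sum>y\<in>G. w x * (1 / h * v y x * A y x * p y))
      - (\<Sum>x\<in>G. \<Sum>y\<in>G. w x * (1 / h * v x y * A x y * p x))"
    by (simp add: sum_distrib_left sum_subtractf right_diff_distrib)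
  also have "(\<Sum>x\<in>G. \<Sum>y\<in>G. w x * (1 / h * v y x * A y x * p y))
      = (\<Sum>x\<in>G. \<Sum>y\<in>G. w y * (1 / h * v x y * A x y * p x))"
    by (rule sum.swap)
  also have "\<dots> - (\<Sum>x\<in>G. \<Sum>y\<in>G. w x * (1 / h * v x y * A x y * p x))
      = (\<Sum>x\<in>G. p x * (\<Sum>y\<in>G. A x y * (v x y * ((w y - w x) / h))))"
    by (simp add: sum_distrib_left flip: sum_subtractf)
      (intro sum.cong refl, simp add: algebra_simps diff_divide_distrib)
  also have "\<dots> = (\<Sum>x\<in>G. p x * (\<Sum>y\<in>G - {x}. A x y * (v x y * ((w y - w x) / h))))"
    using assms by (intro sum.cong refl arg_cong2[where f = "(*)"] sum.mono_neutral_right) auto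
  finally show ?thesis .
qed

text \<open>
  Pairing the value function at time \<open>r\<close> with the density at the reversed time \<open>t - r\<close> makes the
  derivative a \<open>p\<close>-average of Hamiltonian minus linear term, which is exactly the quantity that the
  Fenchel-Young inequality bounds from below by minus the running cost.
\<close>

lemma value_pairing_derivative:
  fixes u :: "'a \<Rightarrow> real \<Rightarrow> real" and p :: "real \<Rightarrow> 'a \<Rightarrow> real" and h t s :: real
  assumes "finite G"
    and u: "\<And>x. x \<in> G \<Longrightarrow>
      (u x has_real_derivative (\<Sum>y\<in>G - {x}. A x y * (exp ((u y s - u x s) / h) - 1))) (at s)"
    and p: "\<And>x. x \<in> G \<Longrightarrow> ((\<lambda>r. p r x) has_real_derivative
      (\<Sum>y\<in>G. 1 / h * v y x * A y x * p (t - s) y - 1 / h * v x y * A x y * p (t - s) x)) (at (t - s))"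
  shows "((\<lambda>r. \<Sum>x\<in>G. u x r * p (t - r) x) has_real_derivative
    (\<Sum>x\<in>G. p (t - s) x * (\<Sum>y\<in>G - {x}.
      A x y * (exp ((u y s - u x s) / h) - 1 - v x y * ((u y s - u x s) / h))))) (at s)"
proof -
  let ?H = "\<lambda>x. \<Sum>y\<in>G - {x}. A x y * (exp ((u y s - u x s) / h) - 1)"
  let ?P = "\<lambda>x. \<Sum>y\<in>G. 1 / h * v y x * A y x * p (t - s) y - 1 / h * v x y * A x y * p (t - s) x"
  have "((\<lambda>r. p (t - r) x) has_real_derivative ?P x * (-1)) (at s)" if "x \<in> G" for x
    by (rule DERIV_chain2[where f = "\<lambda>r. p r x" and g = "\<lambda>r. t - r"])
      (use p[OF that] in \<open>auto intro!: derivative_eq_intros\<close>)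
  hence "((\<lambda>r. \<Sum>x\<in>G. u x r * p (t - r) x) has_real_derivative
      (\<Sum>x\<in>G. ?H x * p (t - s) x + (?P x * (-1)) * u x s)) (at s)"
    by (intro DERIV_sum DERIV_mult u)
  also have "(\<Sum>x\<in>G. ?H x * p (t - s) x + (?P x * (-1)) * u x s)
      = (\<Sum>x\<in>G. p (t - s) x * ?H x) - (\<Sum>x\<in>G. u x s * ?P x)"
    by (simp add: mult.commute flip: sum_subtractf)
  also have "\<dots> = (\<Sum>x\<in>G. p (t - s) x * ?H x)
      - (\<Sum>x\<in>G. p (t - s) x * (\<Sum>y\<in>G - {x}. A x y * (v x y * ((u y s - u x s) / h))))"
    by (subst flux_summation_by_parts[OF \<open>finite G\<close>]) (rule refl)
  also have "\<dots> = (\<Sum>x\<in>G. p (t - s) x * (\<Sum>y\<in>G - {x}.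
      A x y * (exp ((u y s - u x s) / h) - 1 - v x y * ((u y s - u x s) / h))))"
    by (simp add: right_diff_distrib sum_subtractf)
  finally show ?thesis .
qed

text \<open>
  The derivative of the pairing is integrable without any regularity of \<open>v\<close> in time: the
  fundamental theorem of calculus for the Henstock-Kurzweil integral asks only for a continuous
  function that is differentiable at every interior point.
\<close>

lemma value_pairing_has_integral:
  fixes u :: "'a \<Rightarrow> real \<Rightarrow> real" and p :: "real \<Rightarrow> 'a \<Rightarrow> real" and h t :: real
  assumes "finite G" and "t \<ge> 0"
    and u: "\<And>x s. x \<in> G \<Longrightarrow> s \<ge> 0 \<Longrightarrow> (u x has_real_derivative
      (\<Sum>y\<in>G - {x}. A x y * (exp ((u y s - u x s) / h) - 1))) (at s within {0..})"
    and p: "\<And>x s. x \<in> G \<Longrightarrow> s \<in> {0..t} \<Longrightarrow> ((\<lambda>r. p r x) has_real_derivative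
      (\<Sum>y\<in>G. 1 / h * v s y x * A y x * p s y - 1 / h * v s x y * A x y * p s x)) (at s within {0..t})"
  shows "((\<lambda>s. \<Sum>x\<in>G. p (t - s) x * (\<Sum>y\<in>G - {x}.
      A x y * (exp ((u y s - u x s) / h) - 1 - v (t - s) x y * ((u y s - u x s) / h)))) has_integral
      (\<Sum>x\<in>G. u x t * p 0 x) - (\<Sum>x\<in>G. u x 0 * p t x)) {0..t}"
proof -
  let ?F = "\<lambda>r. \<Sum>x\<in>G. u x r * p (t - r) x"
  have "((\<lambda>s. \<Sum>x\<in>G. p (t - s) x * (\<Sum>y\<in>G - {x}.
      A x y * (exp ((u y s - u x s) / h) - 1 - v (t - s) x y * ((u y s - u x s) / h)))) has_integral
      ?F t - ?F 0) {0..t}"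
  proof (rule fundamental_theorem_of_calculus_interior)
    have "continuous_on {0..} (u x)" if "x \<in> G" for x
      using DERIV_continuous[OF u[OF that]] by (simp add: continuous_on_eq_continuous_within)
    hence cu: "continuous_on {0..t} (u x)" if "x \<in> G" for x
      by (rule continuous_on_subset) (use that in auto)
    have "continuous_on {0..t} (\<lambda>r. p r x)" if "x \<in> G" for x
      using DERIV_continuous[OF p[OF that]] by (simp add: continuous_on_eq_continuous_within)
    hence "continuous_on {0..t} (\<lambda>r. p (t - r) x)" if "x \<in> G" for x
      by (rule continuous_on_compose2[of "{0..t}" _ _ "\<lambda>r. t - r"])
        (use that in \<open>auto intro!: continuous_intros\<close>)
    with cu show "continuous_on {0..t} ?F"
      by (intro continuous_intros) auto
  next
    fix s assume s: "s \<in> {0<..<t}"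
    have "(?F has_real_derivative (\<Sum>x\<in>G. p (t - s) x * (\<Sum>y\<in>G - {x}.
      A x y * (exp ((u y s - u x s) / h) - 1 - v (t - s) x y * ((u y s - u x s) / h))))) (at s)"
    proof (rule value_pairing_derivative[OF \<open>finite G\<close>])
      fix x assume "x \<in> G"
      show "(u x has_real_derivative
          (\<Sum>y\<in>G - {x}. A x y * (exp ((u y s - u x s) / h) - 1))) (at s)"
        using u[OF \<open>x \<in> G\<close>, of s] s at_within_interior[of s "{0::real..}"] by simp
      show "((\<lambda>r. p r x) has_real_derivative
          (\<Sum>y\<in>G. 1 / h * v (t - s) y x * A y x * p (t - s) y
            - 1 / h * v (t - s) x y * A x y * p (t - s) x)) (at (t - s))"
        using p[OF \<open>x \<in> G\<close>, of "t - s"] s at_within_interior[of "t - s" "{0..t}"] by simp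
    qed
    thus "(?F has_vector_derivative (\<Sum>x\<in>G. p (t - s) x * (\<Sum>y\<in>G - {x}.
      A x y * (exp ((u y s - u x s) / h) - 1 - v (t - s) x y * ((u y s - u x s) / h))))) (at s)"
      by (simp add: has_real_derivative_iff_has_vector_derivative)
  qed fact
  thus ?thesis by simp
qed

text \<open>
  Weak duality: the integrated Fenchel-Young inequality, weighted by the nonnegative rates and
  densities.
\<close>

lemma controlled_payoff_le_value:
  fixes u :: "'a \<Rightarrow> real \<Rightarrow> real" and p :: "real \<Rightarrow> 'a \<Rightarrow> real" and h t :: real
  assumes "finite G" and "t \<ge> 0"
    and A: "\<And>x y. x \<in> G \<Longrightarrow> y \<in> G \<Longrightarrow> x \<noteq> y \<Longrightarrow> A x y \<ge> 0"
    and u: "\<And>x s. x \<in> G \<Longrightarrow> s \<ge> 0 \<Longrightarrow> (u x has_real_derivative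
      (\<Sum>y\<in>G - {x}. A x y * (exp ((u y s - u x s) / h) - 1))) (at s within {0..})"
    and p: "\<And>x s. x \<in> G \<Longrightarrow> s \<in> {0..t} \<Longrightarrow> ((\<lambda>r. p r x) has_real_derivative
      (\<Sum>y\<in>G. 1 / h * v s y x * A y x * p s y - 1 / h * v s x y * A x y * p s x)) (at s within {0..t})"
    and p_nonneg: "\<And>x s. x \<in> G \<Longrightarrow> s \<in> {0..t} \<Longrightarrow> p s x \<ge> 0"
    and v: "\<And>x y s. x \<in> G \<Longrightarrow> y \<in> G \<Longrightarrow> y \<noteq> x \<Longrightarrow> s \<in> {0..t} \<Longrightarrow> v s x y \<ge> 0"
    and cost: "(\<lambda>s. \<Sum>x\<in>G. (\<Sum>y\<in>G - {x}. A x y *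
      (v (t - s) x y * ln (v (t - s) x y) - v (t - s) x y + 1)) * p (t - s) x) integrable_on {0..t}"
  shows "(\<Sum>x\<in>G. u x 0 * p t x) - integral {0..t} (\<lambda>s. \<Sum>x\<in>G. (\<Sum>y\<in>G - {x}. A x y *
      (v (t - s) x y * ln (v (t - s) x y) - v (t - s) x y + 1)) * p (t - s) x)
    \<le> (\<Sum>x\<in>G. u x t * p 0 x)"
proof -
  have "(\<Sum>x\<in>G. u x 0 * p t x) - (\<Sum>x\<in>G. u x t * p 0 x)
    \<le> integral {0..t} (\<lambda>s. \<Sum>x\<in>G. (\<Sum>y\<in>G - {x}. A x y *
      (v (t - s) x y * ln (v (t - s) x y) - v (t - s) x y + 1)) * p (t - s) x)"
  proof (rule has_integral_le)
    show "((\<lambda>s. - (\<Sum>x\<in>G. p (t - s) x * (\<Sum>y\<in>G - {x}.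
        A x y * (exp ((u y s - u x s) / h) - 1 - v (t - s) x y * ((u y s - u x s) / h))))) has_integral
        (\<Sum>x\<in>G. u x 0 * p t x) - (\<Sum>x\<in>G. u x t * p 0 x)) {0..t}"
      using has_integral_neg[OF value_pairing_has_integral[OF \<open>finite G\<close> \<open>t \<ge> 0\<close> u p]] by simp
    fix s assume s: "s \<in> {0..t}"
    show "- (\<Sum>x\<in>G. p (t - s) x * (\<Sum>y\<in>G - {x}.
        A x y * (exp ((u y s - u x s) / h) - 1 - v (t - s) x y * ((u y s - u x s) / h))))
      \<le> (\<Sum>x\<in>G. (\<Sum>y\<in>G - {x}. A x y *
          (v (t - s) x y * ln (v (t - s) x y) - v (t - s) x y + 1)) * p (t - s) x)"
      unfolding sum_negf[symmetric]
    proof (rule sum_mono)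
      fix x assume x: "x \<in> G"
      have "- (\<Sum>y\<in>G - {x}.
          A x y * (exp ((u y s - u x s) / h) - 1 - v (t - s) x y * ((u y s - u x s) / h)))
        = (\<Sum>y\<in>G - {x}.
          A x y * (v (t - s) x y * ((u y s - u x s) / h) - (exp ((u y s - u x s) / h) - 1)))"
        unfolding sum_negf[symmetric] by (intro sum.cong) (auto simp: algebra_simps)
      also have "\<dots> \<le> (\<Sum>y\<in>G - {x}. A x y *
          (v (t - s) x y * ln (v (t - s) x y) - v (t - s) x y + 1))"
        using x s by (intro sum_mono mult_left_mono exp_fenchel_young v A) auto
      finally have "p (t - s) x * - (\<Sum>y\<in>G - {x}.
          A x y * (exp ((u y s - u x s) / h) - 1 - v (t - s) x y * ((u y s - u x s) / h)))
        \<le> p (t - s) x * (\<Sum>y\<in>G - {x}. A x y *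
          (v (t - s) x y * ln (v (t - s) x y) - v (t - s) x y + 1))"
        using p_nonneg[OF x, of "t - s"] s by (intro mult_left_mono) auto
      thus "- (p (t - s) x * (\<Sum>y\<in>G - {x}.
          A x y * (exp ((u y s - u x s) / h) - 1 - v (t - s) x y * ((u y s - u x s) / h))))
        \<le> (\<Sum>y\<in>G - {x}. A x y *
          (v (t - s) x y * ln (v (t - s) x y) - v (t - s) x y + 1)) * p (t - s) x"
        by (simp add: mult.commute)
    qed
  qed (use cost in \<open>simp add: integrable_integral\<close>)
  thus ?thesis by simp
qed

text \<open>
  For the control \<open>v = exp c\<close> with \<open>c\<close> the difference quotient of the value function, the
  Fenchel-Young inequality is an equality at every time, so the running cost is minus the derivative
  of the pairing. This gives integrability of the cost and its integral together.
\<close>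

lemma gradient_control_cost_has_integral:
  fixes u :: "'a \<Rightarrow> real \<Rightarrow> real" and p :: "real \<Rightarrow> 'a \<Rightarrow> real" and h t :: real
  assumes "finite G" and "t \<ge> 0"
    and u: "\<And>x s. x \<in> G \<Longrightarrow> s \<ge> 0 \<Longrightarrow> (u x has_real_derivative
      (\<Sum>y\<in>G - {x}. A x y * (exp ((u y s - u x s) / h) - 1))) (at s within {0..})"
    and p: "\<And>x s. x \<in> G \<Longrightarrow> s \<in> {0..t} \<Longrightarrow> ((\<lambda>r. p r x) has_real_derivative
      (\<Sum>y\<in>G. 1 / h * v s y x * A y x * p s y - 1 / h * v s x y * A x y * p s x)) (at s within {0..t})"
    and v: "\<And>x y s. y \<noteq> x \<Longrightarrow> v s x y = exp ((u y (t - s) - u x (t - s)) / h)"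
  shows "((\<lambda>s. \<Sum>x\<in>G. (\<Sum>y\<in>G - {x}. A x y *
      (v (t - s) x y * ln (v (t - s) x y) - v (t - s) x y + 1)) * p (t - s) x) has_integral
      (\<Sum>x\<in>G. u x 0 * p t x) - (\<Sum>x\<in>G. u x t * p 0 x)) {0..t}"
proof -
  have "- (\<Sum>x\<in>G. p (t - s) x * (\<Sum>y\<in>G - {x}.
        A x y * (exp ((u y s - u x s) / h) - 1 - v (t - s) x y * ((u y s - u x s) / h))))
      = (\<Sum>x\<in>G. (\<Sum>y\<in>G - {x}. A x y *
          (v (t - s) x y * ln (v (t - s) x y) - v (t - s) x y + 1)) * p (t - s) x)" for s
    unfolding sum_negf[symmetric] mult_minus_right[symmetric]
    by (subst mult.commute, intro sum.cong refl arg_cong2[where f = "(*)"])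
      (auto simp: v algebra_simps intro!: sum.cong)
  thus ?thesis
    using has_integral_neg[OF value_pairing_has_integral[OF \<open>finite G\<close> \<open>t \<ge> 0\<close> u p]] by simp
qed

section \<open>The optimal density as an h-transform\<close>

text \<open>
  The forward equation of a Markov chain. Adding a large multiple \<open>c\<close> of the identity to the
  generator \<open>B\<close> gives a nonnegative matrix \<open>C\<close>; its exponential series has nonnegative terms, and
  the factor \<open>exp (- c * s)\<close> undoes the shift. This yields existence and nonnegativity at once.
\<close>

lemma nonneg_linear_system_solution:
  fixes B :: "'a \<Rightarrow> 'a \<Rightarrow> real"
  assumes "finite G" and B: "\<And>x y. x \<in> G \<Longrightarrow> y \<in> G \<Longrightarrow> x \<noteq> y \<Longrightarrow> B x y \<ge> 0"
  obtains q where
    "\<And>x s. x \<in> G \<Longrightarrow> (q x has_real_derivative (\<Sum>y\<in>G. B y x * q y s)) (at s)"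
    "\<And>x s. x \<in> G \<Longrightarrow> s \<ge> 0 \<Longrightarrow> q x s \<ge> 0"
    "\<And>x. q x 0 = (if x = l then 1 else 0)"
proof -
  define c where "c = (\<Sum>x\<in>G. \<bar>B x x\<bar>)"
  define C where "C x y = B x y + (if x = y then c else 0)" for x y
  have C: "C x y \<ge> 0" if "x \<in> G" "y \<in> G" for x y
  proof (cases "x = y")
    case True
    have "\<bar>B x x\<bar> \<le> c"
      unfolding c_def using \<open>finite G\<close> that by (intro member_le_sum) auto
    thus ?thesis using True by (simp add: C_def)
  qed (use B that in \<open>simp add: C_def\<close>)
  define b where "b = rec_nat (\<lambda>x. if x = l then 1 else 0) (\<lambda>_ g x. \<Sum>y\<in>G. C y x * g y)"
  have b0: "b 0 x = (if x = l then 1 else 0)" and bS: "b (Suc n) x = (\<Sum>y\<in>G. C y x * b n y)" for n x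
    by (simp_all add: b_def)
  have b_nonneg: "x \<in> G \<Longrightarrow> b n x \<ge> 0" for n x
    by (induction n arbitrary: x) (auto simp: b0 bS intro!: sum_nonneg mult_nonneg_nonneg C)
  \<comment> \<open>\<open>K\<close> dominates every column sum of \<open>C\<close>, so the coefficients grow at most geometrically.\<close>
  define K where "K = (\<Sum>x\<in>G. \<Sum>y\<in>G. C y x)"
  have b_le: "x \<in> G \<Longrightarrow> b n x \<le> K ^ n" for n x
  proof (induction n arbitrary: x)
    case (Suc n)
    have "K \<ge> 0" unfolding K_def by (intro sum_nonneg C)
    have "b (Suc n) x \<le> (\<Sum>y\<in>G. C y x * K ^ n)"
      unfolding bS using Suc by (intro sum_mono mult_left_mono C) auto
    also have "\<dots> = (\<Sum>y\<in>G. C y x) * K ^ n"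
      by (simp add: sum_distrib_right)
    also have "(\<Sum>y\<in>G. C y x) \<le> K"
      unfolding K_def using Suc.prems \<open>finite G\<close>
      by (intro member_le_sum[of x G "\<lambda>x. \<Sum>y\<in>G. C y x"]) (auto intro!: sum_nonneg C)
    finally show ?case
      using \<open>K \<ge> 0\<close> by (simp add: mult_right_mono)
  qed (auto simp: b0)
  have summ: "summable (\<lambda>n. b n x / fact n * s ^ n)" if "x \<in> G" for x s
  proof (rule summable_comparison_test)
    show "summable (\<lambda>n. (K * \<bar>s\<bar>) ^ n /\<^sub>R fact n)"
      by (rule summable_exp_generic)
    have "norm (b n x / fact n * s ^ n) \<le> (K * \<bar>s\<bar>) ^ n /\<^sub>R fact n" for n
    proof -
      have "norm (b n x / fact n * s ^ n) = b n x * (\<bar>s\<bar> ^ n / fact n)"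
        using b_nonneg[OF that] by (simp add: abs_mult power_abs)
      also have "\<dots> \<le> K ^ n * (\<bar>s\<bar> ^ n / fact n)"
        by (intro mult_right_mono b_le that) auto
      finally show ?thesis by (simp add: power_mult_distrib field_simps)
    qed
    thus "\<exists>N. \<forall>n\<ge>N. norm (b n x / fact n * s ^ n) \<le> (K * \<bar>s\<bar>) ^ n /\<^sub>R fact n"
      by blast
  qed
  define r where "r x s = (\<Sum>n. b n x / fact n * s ^ n)" for x s
  have r_deriv: "(r x has_real_derivative (\<Sum>y\<in>G. C y x * r y s)) (at s)" if "x \<in> G" for x s
  proof -
    have "(r x has_real_derivative (\<Sum>n. diffs (\<lambda>n. b n x / fact n) n * s ^ n)) (at s)"
      unfolding r_def[abs_def]
      by (rule termdiffs_strong_converges_everywhere) (rule summ[OF that])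
    also have "(\<lambda>n. diffs (\<lambda>n. b n x / fact n) n * s ^ n)
        = (\<lambda>n. \<Sum>y\<in>G. C y x * (b n y / fact n * s ^ n))"
    proof
      fix n
      have "diffs (\<lambda>n. b n x / fact n) n = b (Suc n) x / fact n"
        by (simp add: diffs_def del: of_nat_Suc)
      thus "diffs (\<lambda>n. b n x / fact n) n * s ^ n = (\<Sum>y\<in>G. C y x * (b n y / fact n * s ^ n))"
        by (simp add: bS sum_distrib_right sum_divide_distrib mult.assoc)
    qed
    also have "(\<Sum>n. \<Sum>y\<in>G. C y x * (b n y / fact n * s ^ n)) = (\<Sum>y\<in>G. C y x * r y s)"
      unfolding r_def
      by (simp only: suminf_sum[OF summable_mult[OF summ]] suminf_mult[OF summ] cong: sum.cong)
    finally show ?thesis .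
  qed
  show ?thesis
  proof (rule that[of "\<lambda>x s. exp (- c * s) * r x s"])
    fix x s assume x: "x \<in> G"
    have "(\<Sum>y\<in>G. B y x * r y s) = (\<Sum>y\<in>G. C y x * r y s) - (\<Sum>y\<in>G. (if y = x then c else 0) * r y s)"
      by (simp add: C_def algebra_simps sum.distrib)
    also have "(\<Sum>y\<in>G. (if y = x then c else 0) * r y s) = c * r x s"
      using x \<open>finite G\<close> by (simp add: if_distrib[of "\<lambda>z. z * _"] cong: if_cong)
    finally have *: "(\<Sum>y\<in>G. B y x * r y s) = (\<Sum>y\<in>G. C y x * r y s) - c * r x s" .
    have "((\<lambda>s. exp (- c * s) * r x s) has_real_derivative
        exp (- c * s) * ((\<Sum>y\<in>G. C y x * r y s) - c * r x s)) (at s)"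
      by (rule derivative_eq_intros r_deriv[OF x] refl)+ (simp add: algebra_simps)
    also have "exp (- c * s) * ((\<Sum>y\<in>G. C y x * r y s) - c * r x s)
        = (\<Sum>y\<in>G. B y x * (exp (- c * s) * r y s))"
      unfolding *[symmetric] sum_distrib_left by (intro sum.cong) auto
    finally show "((\<lambda>s. exp (- c * s) * r x s) has_real_derivative
        (\<Sum>y\<in>G. B y x * (exp (- c * s) * r y s))) (at s)" .
  next
    fix x s assume "x \<in> G" "s \<ge> (0::real)"
    thus "exp (- c * s) * r x s \<ge> 0"
      unfolding r_def by (intro mult_nonneg_nonneg suminf_nonneg summ) (auto simp: b_nonneg)
  next
    fix x
    have "r x 0 = b 0 x"
      unfolding r_def using powser_zero[of "\<lambda>n. b n x / fact n"] by simp
    thus "exp (- c * 0) * r x 0 = (if x = l then 1 else 0)"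
      by (simp add: b0)
  qed
qed

text \<open>
  The substitution \<open>\<psi> = exp (u / h)\<close> linearises the Hamilton-Jacobi equation, because
  \<open>exp (u x / h) * exp ((u y - u x) / h) = exp (u y / h)\<close>; the terms \<open>-1\<close> are collected in the
  diagonal entry of \<open>A\<close>.
\<close>

lemma cole_hopf_derivative:
  fixes u :: "'a \<Rightarrow> real \<Rightarrow> real" and h s :: real
  assumes "finite G" and "x \<in> G"
    and diag: "A x x = - (\<Sum>y\<in>G - {x}. A x y)"
    and u: "(u x has_real_derivative
      (\<Sum>y\<in>G - {x}. A x y * (exp ((u y s - u x s) / h) - 1))) (at s within S)"
  shows "((\<lambda>r. exp (u x r / h)) has_real_derivative
    1 / h * (\<Sum>y\<in>G. A x y * exp (u y s / h))) (at s within S)"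
proof -
  have "exp (u x s / h) * (\<Sum>y\<in>G - {x}. A x y * (exp ((u y s - u x s) / h) - 1))
      = (\<Sum>y\<in>G - {x}. A x y * exp (u y s / h)) - (\<Sum>y\<in>G - {x}. A x y) * exp (u x s / h)"
    unfolding sum_distrib_left sum_distrib_right sum_subtractf[symmetric]
  proof (intro sum.cong refl)
    fix y
    have "exp (u x s / h) * exp ((u y s - u x s) / h) = exp (u y s / h)"
      by (simp add: diff_divide_distrib flip: exp_add)
    thus "exp (u x s / h) * (A x y * (exp ((u y s - u x s) / h) - 1))
        = A x y * exp (u y s / h) - A x y * exp (u x s / h)"
      by (simp add: algebra_simps)
  qed
  also have "\<dots> = (\<Sum>y\<in>G. A x y * exp (u y s / h))"
    by (subst sum.remove[OF \<open>finite G\<close> \<open>x \<in> G\<close>]) (simp add: diag)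
  finally have *: "exp (u x s / h) * (\<Sum>y\<in>G - {x}. A x y * (exp ((u y s - u x s) / h) - 1))
      = (\<Sum>y\<in>G. A x y * exp (u y s / h))" .
  have "((\<lambda>r. exp (u x r / h)) has_real_derivative
      exp (u x s / h) * ((\<Sum>y\<in>G - {x}. A x y * (exp ((u y s - u x s) / h) - 1)) / h)) (at s within S)"
    by (rule DERIV_chain2[OF DERIV_exp DERIV_cdivide[OF u]])
  thus ?thesis
    by (simp only: times_divide_eq_right * mult_1 times_divide_eq_left)
qed

text \<open>
  Existence of a density driven by the optimal control. The master equation with that control has
  time-dependent coefficients, but it is solved explicitly by the Doob h-transform
  \<open>p s x = \<psi> x (t - s) * q x s / \<psi> l t\<close>: here \<open>q\<close> solves the uncontrolled forward equation started
  at \<open>l\<close>, and \<open>\<psi> = exp (u / h)\<close> is a positive solution of the backward equation. The control is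
  the ratio \<open>v s x y = \<psi> y (t - s) / \<psi> x (t - s)\<close>, which is what differentiating the product
  produces.
\<close>

lemma doob_transform_density:
  fixes u :: "'a \<Rightarrow> real \<Rightarrow> real" and h t :: real
  assumes "finite G" and "t \<ge> 0" and "h > 0" and "l \<in> G"
    and A: "\<And>x y. x \<in> G \<Longrightarrow> y \<in> G \<Longrightarrow> x \<noteq> y \<Longrightarrow> A x y \<ge> 0"
    and diag: "\<And>x. x \<in> G \<Longrightarrow> A x x = - (\<Sum>y\<in>G - {x}. A x y)"
    and u: "\<And>x s. x \<in> G \<Longrightarrow> s \<ge> 0 \<Longrightarrow> (u x has_real_derivative
      (\<Sum>y\<in>G - {x}. A x y * (exp ((u y s - u x s) / h) - 1))) (at s within {0..})"
    and v: "\<And>x y s. y \<noteq> x \<Longrightarrow> v s x y = exp ((u y (t - s) - u x (t - s)) / h)"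
  obtains p where
    "\<And>x s. x \<in> G \<Longrightarrow> s \<in> {0..t} \<Longrightarrow> p s x \<ge> 0"
    "\<And>x s. x \<notin> G \<Longrightarrow> p s x = 0"
    "\<And>s. s \<in> {0..t} \<Longrightarrow> (\<Sum>x\<in>G. p s x) = 1"
    "\<And>x. x \<in> G \<Longrightarrow> p 0 x = (if x = l then 1 else 0)"
    "\<And>x s. x \<in> G \<Longrightarrow> s \<in> {0..t} \<Longrightarrow> ((\<lambda>r. p r x) has_real_derivative
      (\<Sum>y\<in>G. 1 / h * v s y x * A y x * p s y - 1 / h * v s x y * A x y * p s x)) (at s within {0..t})"
proof -
  define \<psi> where "\<psi> x r = exp (u x r / h)" for x r
  have \<psi>_pos: "\<psi> x r > 0" for x r by (simp add: \<psi>_def)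
  have v_\<psi>: "v s x y * \<psi> x (t - s) = \<psi> y (t - s)" if "y \<noteq> x" for s x y
    using that by (simp add: v \<psi>_def diff_divide_distrib flip: exp_add)
  obtain q where q:
    "\<And>x s. x \<in> G \<Longrightarrow> (q x has_real_derivative (\<Sum>y\<in>G. 1 / h * A y x * q y s)) (at s)"
    "\<And>x s. x \<in> G \<Longrightarrow> s \<ge> 0 \<Longrightarrow> q x s \<ge> 0"
    "\<And>x. q x 0 = (if x = l then 1 else 0)"
    by (rule nonneg_linear_system_solution[of G "\<lambda>x y. 1 / h * A x y" l])
      (use assms in auto)
  define p where "p s x = (if x \<in> G then \<psi> x (t - s) * q x s / \<psi> l t else 0)" for s x
  have p_deriv: "((\<lambda>r. p r x) has_real_derivative
      (\<Sum>y\<in>G. 1 / h * v s y x * A y x * p s y - 1 / h * v s x y * A x y * p s x)) (at s within {0..t})"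
    if x: "x \<in> G" and s: "s \<in> {0..t}" for x s
  proof -
    have "(\<psi> x has_real_derivative 1 / h * (\<Sum>y\<in>G. A x y * \<psi> y (t - s))) (at (t - s) within {0..})"
      unfolding \<psi>_def[abs_def] using x s
      by (intro cole_hopf_derivative \<open>finite G\<close> diag u) auto
    hence "(\<psi> x has_real_derivative 1 / h * (\<Sum>y\<in>G. A x y * \<psi> y (t - s)))
        (at (t - s) within (\<lambda>r. t - r) ` {0..t})"
      by (rule has_field_derivative_subset) auto
    moreover have "((\<lambda>r. t - r) has_real_derivative -1) (at s within {0..t})"
      by (auto intro!: derivative_eq_intros)
    ultimately have "(\<psi> x \<circ> (\<lambda>r. t - r) has_real_derivative
        1 / h * (\<Sum>y\<in>G. A x y * \<psi> y (t - s)) * (-1)) (at s within {0..t})"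
      by (rule DERIV_image_chain)
    hence "((\<lambda>r. \<psi> x (t - r)) has_real_derivative
        1 / h * (\<Sum>y\<in>G. A x y * \<psi> y (t - s)) * (-1)) (at s within {0..t})"
      by (simp add: o_def)
    from DERIV_cdivide[OF DERIV_mult[OF this has_field_derivative_at_within[OF q(1)[OF x]]], of "\<psi> l t"]
    have "((\<lambda>r. p r x) has_real_derivative
        (1 / h * (\<Sum>y\<in>G. A x y * \<psi> y (t - s)) * (-1) * q x s
          + (\<Sum>y\<in>G. 1 / h * A y x * q y s) * \<psi> x (t - s)) / \<psi> l t) (at s within {0..t})"
      using x by (simp add: p_def)
    also have "(1 / h * (\<Sum>y\<in>G. A x y * \<psi> y (t - s)) * (-1) * q x s
          + (\<Sum>y\<in>G. 1 / h * A y x * q y s) * \<psi> x (t - s)) / \<psi> l t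
      = (\<Sum>y\<in>G. (1 / h * A y x * q y s * \<psi> x (t - s) - 1 / h * A x y * \<psi> y (t - s) * q x s) / \<psi> l t)"
      unfolding sum_distrib_left sum_distrib_right sum.distrib[symmetric] sum_divide_distrib
      by (intro sum.cong) (simp_all add: algebra_simps)
    also have "\<dots> = (\<Sum>y\<in>G. 1 / h * v s y x * A y x * p s y - 1 / h * v s x y * A x y * p s x)"
    proof (rule sum.cong)
      fix y assume "y \<in> G"
      show "(1 / h * A y x * q y s * \<psi> x (t - s) - 1 / h * A x y * \<psi> y (t - s) * q x s) / \<psi> l t
        = 1 / h * v s y x * A y x * p s y - 1 / h * v s x y * A x y * p s x"
      \<comment> \<open>For \<open>y = x\<close> both sides vanish; off the diagonal \<open>v\<close> turns one value of \<open>\<psi>\<close> into the other.\<close>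
      proof (cases "y = x")
        case False
        have "1 / h * v s y x * A y x * p s y - 1 / h * v s x y * A x y * p s x
          = (1 / h * A y x * q y s * (v s y x * \<psi> y (t - s))
            - 1 / h * A x y * (v s x y * \<psi> x (t - s)) * q x s) / \<psi> l t"
          using x \<open>y \<in> G\<close> by (simp add: p_def diff_divide_distrib mult_ac)
        thus ?thesis
          by (simp only: v_\<psi>[OF False] v_\<psi>[OF False[symmetric]])
      qed simp
    qed simp
    finally show ?thesis .
  qed
  have p_0: "p 0 x = (if x = l then 1 else 0)" if "x \<in> G" for x
    using that \<psi>_pos[of l t] by (simp add: p_def q(3))
  \<comment> \<open>The total mass is constant: its derivative is the pairing of the flux with the constant 1.\<close>
  have "\<exists>c. \<forall>s\<in>{0..t}. (\<Sum>x\<in>G. p s x) = c"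
  proof (rule has_field_derivative_zero_constant)
    fix s assume s: "s \<in> {0..t}"
    have "((\<lambda>s. \<Sum>x\<in>G. p s x) has_real_derivative (\<Sum>x\<in>G. 1 *
        (\<Sum>y\<in>G. 1 / h * v s y x * A y x * p s y - 1 / h * v s x y * A x y * p s x))) (at s within {0..t})"
      using p_deriv s by (intro DERIV_sum) auto
    thus "((\<lambda>s. \<Sum>x\<in>G. p s x) has_real_derivative 0) (at s within {0..t})"
      unfolding flux_summation_by_parts[OF \<open>finite G\<close>] by simp
  qed simp
  then obtain c where c: "\<And>s. s \<in> {0..t} \<Longrightarrow> (\<Sum>x\<in>G. p s x) = c" by blast
  have "(\<Sum>x\<in>G. p 0 x) = 1"
    using \<open>finite G\<close> \<open>l \<in> G\<close> by (simp add: p_0 cong: sum.cong)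
  with c[of 0] \<open>t \<ge> 0\<close> have "c = 1" by simp
  show ?thesis
  proof (rule that)
    show "p s x \<ge> 0" if "x \<in> G" "s \<in> {0..t}" for x s
      using that q(2)[of x s] \<psi>_pos[of x "t - s"] \<psi>_pos[of l t] by (simp add: p_def)
    show "p s x = 0" if "x \<notin> G" for x s
      using that by (simp add: p_def)
  qed (use p_deriv p_0 c \<open>c = 1\<close> in auto)
qed

section \<open>The equation at the initial time\<close>

text \<open>
  A classical solution satisfies the equation for positive times only. The derivative and the
  right-hand side are both continuous from the right at 0, so the equation persists there; the
  optimal density needs this at its final time.
\<close>

lemma derivative_extends_to_zero:
  fixes g k :: "real \<Rightarrow> real"
  assumes "C1_half_line g" and "\<And>s. s > 0 \<Longrightarrow> (g has_real_derivative k s) (at s)"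
    and "continuous_on {0..} k" and "s \<ge> 0"
  shows "(g has_real_derivative k s) (at s within {0..})"
proof -
  obtain g' where g': "continuous_on {0..} g'"
      "\<And>s. s \<ge> 0 \<Longrightarrow> (g has_real_derivative g' s) (at s within {0..})"
    using assms(1) unfolding C1_half_line_def by blast
  have eq: "g' r = k r" if "r > 0" for r
  proof -
    have "(g has_real_derivative g' r) (at r)"
      using g'(2)[of r] that at_within_interior[of r "{0::real..}"] by simp
    thus ?thesis using assms(2)[OF that] DERIV_unique by blast
  qed
  have "g' 0 = k 0"
  proof (rule tendsto_unique)
    show "(g' \<longlongrightarrow> g' 0) (at_right 0)"
      using g'(1) unfolding continuous_on_def
      by (auto intro: tendsto_within_subset[of _ _ 0 "{0..}"])
    have "(k \<longlongrightarrow> k 0) (at_right 0)"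
      using assms(3) unfolding continuous_on_def
      by (auto intro: tendsto_within_subset[of _ _ 0 "{0..}"])
    thus "(g' \<longlongrightarrow> k 0) (at_right 0)"
      by (rule Lim_transform_eventually) (auto simp: eq eventually_at_filter)
  qed simp
  thus ?thesis using g'(2)[OF assms(4)] eq[of s] assms(4) by (cases "s = 0") auto
qed

section \<open>The variational representation\<close>

theorem proposition2p7:
  fixes \<Omega> :: "(real ^ 'n) set"
    and M :: nat
    and \<nu> :: "nat \<Rightarrow> int ^ 'n"
    and \<Phi>p \<Phi>m :: "nat \<Rightarrow> real ^ 'n \<Rightarrow> real"
    and c0 h t :: real
    and f :: "real ^ 'n \<Rightarrow> real"
    and u :: "real ^ 'n \<Rightarrow> real \<Rightarrow> real"
    and l :: "real ^ 'n"
  assumes "open \<Omega>" and "connected \<Omega>" and "\<Omega> \<noteq> {}" and "bounded \<Omega>"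
    and "closure \<Omega> \<subseteq> pos_orthant"
    and "c0 > 0"
    and "\<And>j. j \<in> {1..M} \<Longrightarrow> continuous_on (closure \<Omega>) (\<Phi>p j)"
    and "\<And>j. j \<in> {1..M} \<Longrightarrow> continuous_on (closure \<Omega>) (\<Phi>m j)"
    and "\<And>j x. j \<in> {1..M} \<Longrightarrow> x \<in> closure \<Omega> \<Longrightarrow> \<Phi>p j x \<ge> c0"
    and "\<And>j x. j \<in> {1..M} \<Longrightarrow> x \<in> closure \<Omega> \<Longrightarrow> \<Phi>m j x \<ge> c0"
    and "h > 0"
    and "classical_solution \<Omega> M \<nu> \<Phi>p \<Phi>m h u"
    and "\<And>x. x \<in> dom_grid \<Omega> h \<Longrightarrow> u x 0 = f x"
    and "l \<in> dom_grid \<Omega> h"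
    and "t \<ge> 0"
  shows "is_maximum (u l t) {payoff \<Omega> M \<nu> \<Phi>p \<Phi>m h f t v p | v p. admissible \<Omega> M \<nu> \<Phi>p \<Phi>m h l t v p}"
proof -
  define G where "G = dom_grid \<Omega> h"
  define A where "A = rate \<Omega> M \<nu> \<Phi>p \<Phi>m h"
  have fin: "finite G"
    unfolding G_def by (rule finite_dom_grid) fact+
  have G_sub: "G \<subseteq> lattice h" "G \<subseteq> closure \<Omega>"
    by (auto simp: G_def dom_grid_def)
  have A_nonneg: "A x y \<ge> 0" if "x \<in> G" "x \<noteq> y" for x y
    unfolding A_def
  proof (rule rate_nonneg)
    fix j assume "j \<in> {1..M}"
    moreover have "x \<in> closure \<Omega>" using that G_sub by blast
    ultimately show "\<Phi>p j x \<ge> 0" "\<Phi>m j x \<ge> 0"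
      using assms(9)[of j x] assms(10)[of j x] \<open>c0 > 0\<close> by auto
  qed (use that in auto)
  have A_diag: "A x x = - (\<Sum>y\<in>G - {x}. A x y)" for x
    using rate_diagonal fin unfolding A_def G_def by blast
  have hj: "hj_rhs \<Omega> M \<nu> \<Phi>p \<Phi>m h w x = (\<Sum>y\<in>G - {x}. A x y * (exp ((w y - w x) / h) - 1))" for w x
    using hj_rhs_eq_rate_sum fin unfolding A_def G_def by blast
  have cost: "running_cost \<Omega> M \<nu> \<Phi>p \<Phi>m h x w
      = (\<Sum>y\<in>G - {x}. A x y * (w y * ln (w y) - w y + 1))" for x w
    unfolding A_def G_def running_cost_def
    by (rule sum_nbrs_eq) (use fin in \<open>simp add: G_def\<close>)
  have u_cont: "continuous_on {0..} (u x)" if "x \<in> G" for x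
  proof -
    have "C1_half_line (u x)"
      using assms(12) that by (auto simp: classical_solution_def G_def)
    thus ?thesis
      unfolding C1_half_line_def continuous_on_eq_continuous_within
      by (auto intro: DERIV_continuous)
  qed
  have u_deriv: "(u x has_real_derivative
      (\<Sum>y\<in>G - {x}. A x y * (exp ((u y s - u x s) / h) - 1))) (at s within {0..})"
    if "x \<in> G" "s \<ge> 0" for x s
  proof (rule derivative_extends_to_zero)
    show "C1_half_line (u x)"
      and "\<And>s. s > 0 \<Longrightarrow> (u x has_real_derivative
        (\<Sum>y\<in>G - {x}. A x y * (exp ((u y s - u x s) / h) - 1))) (at s)"
      using assms(12) that(1) by (auto simp: classical_solution_def hj G_def[symmetric])
    show "continuous_on {0..} (\<lambda>s. \<Sum>y\<in>G - {x}. A x y * (exp ((u y s - u x s) / h) - 1))"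
      using \<open>h > 0\<close> that(1) by (intro continuous_intros u_cont) auto
  qed fact
  have start: "(\<Sum>x\<in>G. u x t * p 0 x) = u l t"
    if "\<And>x. x \<in> G \<Longrightarrow> p 0 x = (if x = l then 1 else 0)" for p :: "real \<Rightarrow> real ^ 'n \<Rightarrow> real"
    using fin assms(14) by (simp add: that G_def[symmetric] if_distrib[of "(*) _"] cong: if_cong sum.cong)
  have payoff_eq: "payoff \<Omega> M \<nu> \<Phi>p \<Phi>m h f t v p = (\<Sum>x\<in>G. u x 0 * p t x)
      - integral {0..t} (\<lambda>s. \<Sum>x\<in>G. (\<Sum>y\<in>G - {x}. A x y *
        (v (t - s) x y * ln (v (t - s) x y) - v (t - s) x y + 1)) * p (t - s) x)" for v p
    unfolding payoff_def cost G_def[symmetric] using assms(13) by (simp add: G_def)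

  have upper: "payoff \<Omega> M \<nu> \<Phi>p \<Phi>m h f t v p \<le> u l t"
    if adm: "admissible \<Omega> M \<nu> \<Phi>p \<Phi>m h l t v p" for v p
  proof -
    note adm' = adm[unfolded admissible_def cost, folded G_def A_def]
    have "payoff \<Omega> M \<nu> \<Phi>p \<Phi>m h f t v p \<le> (\<Sum>x\<in>G. u x t * p 0 x)"
      unfolding payoff_eq
      by (rule controlled_payoff_le_value[OF fin \<open>t \<ge> 0\<close> A_nonneg u_deriv])
        (use adm' G_sub in blast)+
    also have "\<dots> = u l t"
      using adm' by (intro start) blast
    finally show ?thesis .
  qed

  \<comment> \<open>The diagonal entry is dictated by the constraint that the rows of \<open>v\<close> times the rates sum to
    zero. If \<open>A x x\<close> vanishes, so do all rates out of \<open>x\<close>, and any value will do.\<close>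
  define v where "v s x y = (if y = x
      then if A x x = 0 then 0
        else - (\<Sum>z\<in>G - {x}. exp ((u z (t - s) - u x (t - s)) / h) * A x z) / A x x
      else exp ((u y (t - s) - u x (t - s)) / h))" for s x y
  have v_off: "v s x y = exp ((u y (t - s) - u x (t - s)) / h)" if "y \<noteq> x" for s x y
    using that by (simp add: v_def)
  obtain p where p:
    "\<And>x s. x \<in> G \<Longrightarrow> s \<in> {0..t} \<Longrightarrow> p s x \<ge> 0"
    "\<And>x s. x \<notin> G \<Longrightarrow> p s x = 0"
    "\<And>s. s \<in> {0..t} \<Longrightarrow> (\<Sum>x\<in>G. p s x) = 1"
    "\<And>x. x \<in> G \<Longrightarrow> p 0 x = (if x = l then 1 else 0)"
    "\<And>x s. x \<in> G \<Longrightarrow> s \<in> {0..t} \<Longrightarrow> ((\<lambda>r. p r x) has_real_derivative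
      (\<Sum>y\<in>G. 1 / h * v s y x * A y x * p s y - 1 / h * v s x y * A x y * p s x)) (at s within {0..t})"
    by (rule doob_transform_density[OF fin \<open>t \<ge> 0\<close> \<open>h > 0\<close> _ A_nonneg A_diag u_deriv v_off])
      (use assms(14) in \<open>auto simp: G_def\<close>)
  have int: "((\<lambda>s. \<Sum>x\<in>G. (\<Sum>y\<in>G - {x}. A x y *
      (v (t - s) x y * ln (v (t - s) x y) - v (t - s) x y + 1)) * p (t - s) x) has_integral
      (\<Sum>x\<in>G. u x 0 * p t x) - (\<Sum>x\<in>G. u x t * p 0 x)) {0..t}"
    by (rule gradient_control_cost_has_integral[OF fin \<open>t \<ge> 0\<close> u_deriv p(5) v_off])
  have v_balanced: "(\<Sum>y\<in>G. v s x y * A x y) = 0" if "x \<in> G" for s x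
  proof -
    have "(\<Sum>y\<in>G. v s x y * A x y) = v s x x * A x x + (\<Sum>y\<in>G - {x}. v s x y * A x y)"
      by (rule sum.remove[OF fin that])
    also have "\<dots> = 0"
    proof (cases "A x x = 0")
      case True
      hence "(\<Sum>y\<in>G - {x}. A x y) = 0" using A_diag[of x] by simp
      hence "\<forall>y\<in>G - {x}. A x y = 0"
        by (subst (asm) sum_nonneg_eq_0_iff) (use fin A_nonneg[OF that] in auto)
      thus ?thesis by (simp add: True)
    next
      case False
      have "(\<Sum>y\<in>G - {x}. v s x y * A x y)
          = (\<Sum>z\<in>G - {x}. exp ((u z (t - s) - u x (t - s)) / h) * A x z)"
        by (intro sum.cong) (auto simp: v_off)
      thus ?thesis using False by (simp add: v_def)
    qed
    finally show ?thesis .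
  qed
  have "admissible \<Omega> M \<nu> \<Phi>p \<Phi>m h l t v p"
    unfolding admissible_def cost
    unfolding G_def[symmetric] A_def[symmetric]
  proof (intro conjI ballI impI)
    fix s assume s: "s \<in> {0..t}"
    show "p s x \<ge> 0" for x
      using p(1)[of x s] p(2)[of x s] s by (cases "x \<in> G") auto
    have "(p s has_sum (\<Sum>x\<in>G. p s x)) G"
      using fin by (rule has_sum_finite)
    thus "(p s has_sum 1) (lattice h)"
      unfolding p(3)[OF s]
      by (rule has_sum_cong_neutral[THEN iffD1, rotated -1]) (use p(2) G_sub in auto)
    have "((\<lambda>_. 0) has_sum (0 :: real)) (lattice h - G)"
      by (rule has_sum_0) simp
    thus "(p s has_sum 0) (lattice h - G)"
      by (rule has_sum_cong[THEN iffD1, rotated]) (simp add: p(2))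
  next
    show "(\<lambda>s. \<Sum>x\<in>G. (\<Sum>y\<in>G - {x}. A x y *
      (v (t - s) x y * ln (v (t - s) x y) - v (t - s) x y + 1)) * p (t - s) x) integrable_on {0..t}"
      using int by blast
  qed (use p(4,5) v_balanced v_off in auto)
  moreover have "payoff \<Omega> M \<nu> \<Phi>p \<Phi>m h f t v p = u l t"
    unfolding payoff_eq integral_unique[OF int] using start[of p] p(4) by simp
  ultimately have "u l t \<in> {payoff \<Omega> M \<nu> \<Phi>p \<Phi>m h f t v p | v p. admissible \<Omega> M \<nu> \<Phi>p \<Phi>m h l t v p}"
    by (intro CollectI exI[of _ v] exI[of _ p]) simp
  thus ?thesis
    unfolding is_maximum_def using upper by blast
qed

end
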